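(* Consider the multi-agent system and the predictor-like protocol described in the context, with $N\ge2$ agents. Assume that all eigenvalues of $A$ are on or outside the unit circle, that $B$ has full column rank, that the undirected graph $\mathcal{G}$ is connected, and that $\mathrm{Rank}(B)=1$. If the multi-agent system is mean-square consensusable under the predictor-like protocol, then $$\prod_i|\lambda_i^u(A)|^2<\left(\frac{1+\lambda_2(L_G)/\lambda_N(L_G)}{1-\lambda_2(L_G)/\lambda_N(L_G)}\right)^2,$$ where $\lambda_i^u(A)$ denote the unstable eigenvalues of $A$ (those on or outside the unit circle, counted with algebraic multiplicity), and the right-hand side is read as $+\infty$ when $\lambda_2(L_G)=\lambda_N(L_G)$.
   Context: Graph: $\mathcal{G}$ is an undirected graph on vertices $\{1,\dots,N\}$ with symmetric weighted adjacency matrix $\mathcal{A}=[a_{ij}]$, $a_{ij}\ge 0$, and $a_{ij}>0$ iff $(i,j)$ is an edge. $N_i$ is the set of neighbours of $i$. The Laplacian is $L_G=\mathcal{D}-\mathcal{A}$ with $\mathcal{D}=\mathrm{diag}(d_1,\dots,d_N)$, $d_i=\sum_j a_{ij}$. Its eigenvalues are ordered $0=\lambda_1(L_G)\le\lambda_2(L_G)\le\cdots\le\lambda_N(L_G)$. System: for $i=1,\dots,N$ and $k\ge0$, $$x_i(k+1)=Ax_i(k)+\gamma(k)Bu_i(k-d),$$ with $x_i\in\mathbb{R}^n$, $u_i\in\mathbb{R}^m$, constant real matrices $A,B$, integer delay $d\ge0$, and $\{\gamma(k)\}_{k\ge0}$ i.i.d. Bernoulli (the same process for all agents) with $P(\gamma(k)=0)=p$,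 $P(\gamma(k)=1)=1-p$, $p\in(0,1)$. The initial values $x_i(0),u_i(-1),\dots,u_i(-d)$ are given. Put $\mu=1-p$. Predictor-like protocol with gain $K\in\mathbb{R}^{m\times n}$: for $k\ge d$, $$\hat x_i(k|k-d)=A^dx_i(k-d)+\mu\sum_{j=1}^{d}A^{j-1}Bu_i(k-d-j),$$ $$u_i(k-d)=K\sum_{j\in N_i}a_{ij}\big[\hat x_j(k|k-d)-\hat x_i(k|k-d)\big].$$ Mean-square consensusable under the protocol: there exists a gain $K$ such that, for any finite initial values, the protocol yields $\lim_{k\to\infty}E\|x_j(k)-x_i(k)\|^2=0$ for all $i,j$. *)

theory Defs
  imports
    "HOL-Probability.Probability"
    "HOL-Computational_Algebra.Computational_Algebra"
begin

text \<open>
  Eigenvalues of a real square matrix: the multiset of complex roots of \<open>det (z I - M)\<close>,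
  so every eigenvalue occurs with its algebraic multiplicity.
\<close>

definition charpoly :: "'a::comm_ring_1^'n^'n \<Rightarrow> 'a poly" where
  "charpoly M = det (mat [:0, 1:] - map_matrix (\<lambda>c. [:c:]) M)"

definition eigvals :: "real^'n^'n \<Rightarrow> complex multiset" where
  "eigvals M = proots (charpoly (map_matrix complex_of_real M))"

definition unstable_eigvals :: "real^'n^'n \<Rightarrow> complex multiset" where
  "unstable_eigvals M = {#z \<in># eigvals M. 1 \<le> cmod z#}"

text \<open>
  Powers with respect to the matrix product \<open>**\<close>; the overloaded \<open>^\<close> on vectors is
  componentwise.
\<close>

primrec mat_pow :: "'a::semiring_1^'n^'n \<Rightarrow> nat \<Rightarrow> 'a^'n^'n" where
  "mat_pow M 0 = mat 1"
| "mat_pow M (Suc k) = M ** mat_pow M k"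

text \<open>A weighted undirected graph on the vertex type is given by its weighted adjacency matrix.\<close>

definition weighted_adjacency :: "real^'v^'v \<Rightarrow> bool" where
  "weighted_adjacency W \<longleftrightarrow> (\<forall>i j. W $ i $ j = W $ j $ i \<and> 0 \<le> W $ i $ j)"

definition neighbours :: "real^'v^'v \<Rightarrow> 'v \<Rightarrow> 'v set" where
  "neighbours W i = {j. 0 < W $ i $ j}"

definition connected_graph :: "real^'v^'v \<Rightarrow> bool" where
  "connected_graph W \<longleftrightarrow> (\<forall>i j. (i, j) \<in> {(i, j). j \<in> neighbours W i}\<^sup>*)"

definition laplacian :: "real^'v^'v \<Rightarrow> real^'v^'v" where
  "laplacian W = (\<chi> i j. if i = j then \<Sum>k\<in>UNIV. W $ i $ k else 0) - W"

text \<open>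
  The \<open>k\<close>-th smallest Laplacian eigenvalue, counting from 1 with multiplicity, for
  \<open>1 \<le> k \<le> CARD('v)\<close>. The Laplacian is symmetric, so its eigenvalues are real and \<open>Re\<close> only
  changes their type.
\<close>

definition laplacian_eigval :: "real^'v^'v \<Rightarrow> nat \<Rightarrow> real" where
  "laplacian_eigval W k =
     sorted_list_of_multiset (image_mset Re (eigvals (laplacian W))) ! (k - 1)"

definition iid_bernoulli :: "'w measure \<Rightarrow> (nat \<Rightarrow> 'w \<Rightarrow> real) \<Rightarrow> real \<Rightarrow> bool" where
  "iid_bernoulli M \<gamma> p \<longleftrightarrow>
     prob_space.indep_vars M (\<lambda>_. borel) \<gamma> UNIV \<and>
     (\<forall>k. measure M {\<omega> \<in> space M. \<gamma> k \<omega> = 0} = p \<and>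
          measure M {\<omega> \<in> space M. \<gamma> k \<omega> = 1} = 1 - p)"

text \<open>
  Sample paths. \<open>g\<close> is a realisation of the channel process, \<open>x k i\<close> the state of agent \<open>i\<close> at
  time \<open>k\<close>, and \<open>u t i\<close> its input at time \<open>t\<close>, where integer times accommodate the initial
  inputs \<open>u (-1), \<dots>, u (-d)\<close>.
\<close>

definition dynamics ::
  "real^'n^'n \<Rightarrow> real^'m^'n \<Rightarrow> nat \<Rightarrow> (nat \<Rightarrow> real) \<Rightarrow>
   (nat \<Rightarrow> 'v \<Rightarrow> real^'n) \<Rightarrow> (int \<Rightarrow> 'v \<Rightarrow> real^'m) \<Rightarrow> bool" where
  "dynamics A B d g x u \<longleftrightarrow>
     (\<forall>k i. x (k + 1) i = A *v x k i + g k *\<^sub>R (B *v u (int k - int d) i))"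

text \<open>The prediction \<open>x\<^sub>i(k|k-d)\<close>, used only for \<open>k \<ge> d\<close>.\<close>

definition prediction ::
  "real^'n^'n \<Rightarrow> real^'m^'n \<Rightarrow> real \<Rightarrow> nat \<Rightarrow>
   (nat \<Rightarrow> 'v \<Rightarrow> real^'n) \<Rightarrow> (int \<Rightarrow> 'v \<Rightarrow> real^'m) \<Rightarrow> nat \<Rightarrow> 'v \<Rightarrow> real^'n" where
  "prediction A B \<mu> d x u k i =
     mat_pow A d *v x (k - d) i +
     \<mu> *\<^sub>R (\<Sum>j = 1..d. mat_pow A (j - 1) *v (B *v u (int k - int d - int j) i))"

definition predictor_protocol ::
  "real^'n^'n \<Rightarrow> real^'m^'n \<Rightarrow> real \<Rightarrow> nat \<Rightarrow> real^'v^'v \<Rightarrow> real^'n^'m \<Rightarrow>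
   (nat \<Rightarrow> 'v \<Rightarrow> real^'n) \<Rightarrow> (int \<Rightarrow> 'v \<Rightarrow> real^'m) \<Rightarrow> bool" where
  "predictor_protocol A B \<mu> d W K x u \<longleftrightarrow>
     (\<forall>k\<ge>d. \<forall>i. u (int k - int d) i =
        K *v (\<Sum>j\<in>neighbours W i.
          W $ i $ j *\<^sub>R (prediction A B \<mu> d x u k j - prediction A B \<mu> d x u k i)))"

text \<open>
  The initial values \<open>x0\<close>, \<open>u0\<close> are deterministic; \<open>u0 t\<close> matters only for \<open>-d \<le> t \<le> -1\<close>.
  They determine the trajectory on \<open>space M\<close>, where \<open>x k\<close> is a function of
  \<open>\<gamma> 0, \<dots>, \<gamma> (k - 1)\<close>. If each \<open>\<gamma> k\<close> is almost surely 0 or 1, the expectations are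
  therefore integrals of integrable functions.
\<close>

definition ms_consensusable ::
  "'w measure \<Rightarrow> (nat \<Rightarrow> 'w \<Rightarrow> real) \<Rightarrow> real \<Rightarrow> nat \<Rightarrow>
   real^'n^'n \<Rightarrow> real^'m^'n \<Rightarrow> real^'v^'v \<Rightarrow> bool" where
  "ms_consensusable M \<gamma> p d A B W \<longleftrightarrow>
     (\<exists>K :: real^'n^'m.
        \<forall>(x0 :: 'v \<Rightarrow> real^'n) (u0 :: int \<Rightarrow> 'v \<Rightarrow> real^'m)
         (x :: nat \<Rightarrow> 'v \<Rightarrow> 'w \<Rightarrow> real^'n) (u :: int \<Rightarrow> 'v \<Rightarrow> 'w \<Rightarrow> real^'m).
          (\<forall>\<omega>\<in>space M.
             (\<forall>i. x 0 i \<omega> = x0 i) \<and>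
             (\<forall>t\<in>{- int d..-1}. \<forall>i. u t i \<omega> = u0 t i) \<and>
             dynamics A B d (\<lambda>k. \<gamma> k \<omega>) (\<lambda>k i. x k i \<omega>) (\<lambda>t i. u t i \<omega>) \<and>
             predictor_protocol A B (1 - p) d W K (\<lambda>k i. x k i \<omega>) (\<lambda>t i. u t i \<omega>)) \<longrightarrow>
          (\<forall>i j. (\<lambda>k. \<integral>\<omega>. (norm (x k j \<omega> - x k i \<omega>))\<^sup>2 \<partial>M) \<longlonglongrightarrow> 0))"

end

theory Submission
  imports Defs
begin

text \<open>
  The predictor is unbiased: taking expectations, with \<open>\<gamma> k\<close> independent of \<open>u (k - d)\<close>, turns
  it into an exact prediction of the mean state. Along an eigenvector of the Laplacian with
  eigenvalue \<open>\<lambda> \<noteq> 0\<close> the mean state therefore evolves under \<open>A - \<mu> \<lambda> B K\<close>, and mean-square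
  consensus makes the powers of this matrix vanish, so its determinant has modulus less than 1.
  Since \<open>B K\<close> has rank one, this determinant is an affine function \<open>det A - \<mu> \<lambda> a\<close> of \<open>\<lambda>\<close>, and
  the two constraints at \<open>\<lambda>\<^sub>2\<close> and \<open>\<lambda>\<^sub>N\<close> bound \<open>\<bar>det A\<bar>\<close>, the product of the moduli of the
  eigenvalues of \<open>A\<close>.
\<close>

no_notation fps_nth (infixl "$" 75)

section \<open>Characteristic polynomials\<close>

abbreviation cmatrix :: "real^'n^'m \<Rightarrow> complex^'n^'m" where
  "cmatrix \<equiv> map_matrix complex_of_real"

lemma poly_det: "poly (det P) z = det (map_matrix (\<lambda>q. poly q z) P)"
  unfolding det_def by (simp add: poly_sum poly_prod)

lemma poly_charpoly: "poly (charpoly M) z = det (mat z - M)"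
  unfolding charpoly_def poly_det
  by (rule arg_cong[where f=det]) (simp add: vec_eq_iff mat_def)

lemma det_cmatrix: "det (cmatrix M) = complex_of_real (det M)"
  unfolding det_def by simp

text \<open>In the Leibniz expansion only the identity permutation reaches degree
  \<open>CARD('n)\<close>: any other one moves some index, and the off-diagonal entry there is
  constant. So the monic product of the diagonal entries dominates.\<close>

lemma charpoly_degree_lead:
  fixes M :: "'a::idom^'n^'n"
  shows degree_charpoly: "degree (charpoly M) = CARD('n)"
    and lead_coeff_charpoly: "lead_coeff (charpoly M) = 1"
proof -
  define P where "P = mat [:0, 1:] - map_matrix (\<lambda>c. [:c:]) M"
  define t where "t p = of_int (sign p) * (\<Prod>i\<in>UNIV. P $ i $ p i)" for p :: "'n \<Rightarrow> 'n"
  have P: "P $ i $ j = (if i = j then [:- M $ i $ j, 1:] else [:- M $ i $ j:])" for i j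
    by (simp add: P_def mat_def)
  have t_id: "degree (t id) = CARD('n)" "lead_coeff (t id) = 1"
  proof -
    have t: "t id = (\<Prod>i\<in>UNIV. [:- M $ i $ i, 1:])" by (simp add: t_def P sign_id)
    show "degree (t id) = CARD('n)" unfolding t by (subst degree_prod_sum_eq) auto
    show "lead_coeff (t id) = 1" unfolding t lead_coeff_prod by simp
  qed
  have t_deg: "degree (t p) < CARD('n)" if p: "p \<noteq> id" for p
  proof -
    have "degree (\<Prod>i\<in>UNIV. P $ i $ p i) \<le> (\<Sum>i\<in>UNIV. degree (P $ i $ p i))"
      using degree_prod_sum_le[of UNIV "\<lambda>i. P $ i $ p i"] by (simp add: comp_def)
    also have "\<dots> < (\<Sum>i\<in>(UNIV::'n set). 1)"
    proof -
      obtain i where "p i \<noteq> i" using p by (auto simp: fun_eq_iff)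
      then show ?thesis by (intro sum_strict_mono_ex1) (auto simp: P intro: exI[of _ i])
    qed
    finally have "degree (\<Prod>i\<in>UNIV. P $ i $ p i) < CARD('n)" by simp
    moreover have "degree (t p) \<le> degree (\<Prod>i\<in>UNIV. P $ i $ p i)"
      unfolding t_def by (rule sign_cases[of p]) simp_all
    ultimately show ?thesis by simp
  qed
  define r where "r = (\<Sum>p | p permutes UNIV \<and> p \<noteq> id. t p)"
  have "degree r < CARD('n)"
    unfolding r_def by (rule degree_sum_less) (auto simp: t_deg)
  moreover have "charpoly M = r + t id"
  proof -
    have "{p :: 'n \<Rightarrow> 'n. p permutes UNIV} = insert id {p. p permutes UNIV \<and> p \<noteq> id}"
      by (auto simp: permutes_id)
    then show ?thesis
      unfolding charpoly_def det_def P_def[symmetric] t_def[symmetric] r_def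
      by (simp add: finite_permutations add.commute)
  qed
  ultimately have "degree r < degree (t id)" "charpoly M = r + t id" using t_id by simp_all
  then show "degree (charpoly M) = CARD('n)" "lead_coeff (charpoly M) = 1"
    using t_id degree_add_eq_right[of r "t id"] lead_coeff_add_le[of r "t id"] by metis+
qed

lemma charpoly_nonzero: "charpoly (M :: 'a::idom^'n^'n) \<noteq> 0"
  using lead_coeff_charpoly[of M] by force

section \<open>Eigenvalue multisets: determinants and real spectra of symmetric matrices\<close>

lemma size_eigvals: "size (eigvals (S :: real^'n^'n)) = CARD('n)"
  by (simp add: eigvals_def size_proots_complex degree_charpoly)

lemma norm_prod_mset: "norm (\<Prod>x\<in>#X. f x :: complex) = (\<Prod>x\<in>#X. norm (f x))"
  by (induction X) (auto simp: norm_mult)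

text \<open>Evaluating the factored monic characteristic polynomial at 0 gives
  \<open>det (- S)\<close> as the product of the negated eigenvalues; the signs disappear in the
  modulus.\<close>

lemma prod_cmod_eigvals: "(\<Prod>z\<in>#eigvals S. cmod z) = \<bar>det S\<bar>"
  for S :: "real^'n^'n"
proof -
  have "charpoly (cmatrix S) = (\<Prod>x\<in>#eigvals S. [:- x, 1:])"
    using complex_poly_decompose_multiset[of "charpoly (cmatrix S)"]
    by (simp add: eigvals_def lead_coeff_charpoly)
  then have "poly (charpoly (cmatrix S)) 0 = (\<Prod>x\<in>#eigvals S. - x)"
    by (simp add: poly_prod_mset multiset.map_comp comp_def)
  then have "(\<Prod>x\<in>#eigvals S. - x) = det (mat 0 - cmatrix S)"
    unfolding poly_charpoly by (rule sym)
  moreover have "mat 0 - cmatrix S = cmatrix (- S)" by (simp add: vec_eq_iff mat_def)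
  ultimately have "norm (\<Prod>x\<in>#eigvals S. - x) = \<bar>det (- S)\<bar>"
    by (simp add: det_cmatrix)
  moreover have "\<bar>det (- S)\<bar> = \<bar>det S\<bar>"
  proof -
    have "- S = mat (-1) ** S" 
      by (simp add: vec_eq_iff matrix_matrix_mult_def mat_def if_distrib[where f="\<lambda>x. x * _"] cong: if_cong)
    moreover have "det (mat (-1) :: real^'n^'n) = (-1) ^ CARD('n)"
      by (subst det_diagonal) (auto simp: mat_def)
    ultimately show ?thesis by (simp add: det_mul abs_mult power_abs)
  qed
  ultimately show ?thesis by (simp add: norm_prod_mset)
qed

lemma det_eq_0_kernel:
  fixes T :: "'a::field^'n^'n"
  assumes "det T = 0"
  obtains v where "v \<noteq> 0" "T *v v = 0"
proof -
  have "\<not> (\<exists>B. B ** T = mat 1)"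
    using assms invertible_det_nz[of T] by (auto simp: invertible_left_inverse)
  then show ?thesis using that unfolding matrix_left_invertible_ker by blast
qed

text \<open>For a complex eigenvector \<open>w\<close>, the Hermitian form \<open>q\<close> of
  \<open>S\<close> at \<open>w\<close> is real and equals \<open>z\<close> times the squared norm of
  \<open>w\<close>, so \<open>z\<close> is real. The real matrix \<open>mat (Re z) - S\<close> is
  then singular and has a real kernel vector.\<close>

lemma eigvals_symmetric:
  fixes S :: "real^'n^'n"
  assumes sym: "\<And>i j. S $ i $ j = S $ j $ i" and z: "z \<in># eigvals S"
  obtains v :: "real^'n" where "v \<noteq> 0" "S *v v = Re z *\<^sub>R v" "z = complex_of_real (Re z)"
proof -
  have "det (mat z - cmatrix S) = 0"
    using z by (simp add: eigvals_def charpoly_nonzero flip: poly_charpoly)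
  then obtain w where w: "w \<noteq> 0" "(mat z - cmatrix S) *v w = 0" by (rule det_eq_0_kernel)
  have eig: "z * w $ i = (\<Sum>j\<in>UNIV. S $ i $ j * w $ j)" for i
    using w(2) unfolding vec_eq_iff matrix_vector_mult_def
    by (simp add: mat_def left_diff_distrib sum_subtractf if_distrib[where f="\<lambda>x. x * _"] cong: if_cong)
  define q where "q = (\<Sum>i\<in>UNIV. \<Sum>j\<in>UNIV. cnj (w $ i) * S $ i $ j * w $ j)"
  have "z * (\<Sum>i\<in>UNIV. of_real ((cmod (w $ i))\<^sup>2)) = q"
    unfolding q_def sum_distrib_left
    by (intro sum.cong refl) (simp add: eig[symmetric] sum_distrib_left[symmetric] mult.assoc
       complex_norm_square mult.left_commute del: of_real_power)
  moreover have "cnj q = q"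
    unfolding q_def by (simp, subst sum.swap) (simp add: sym mult_ac)
  then have "q \<in> \<real>" by (simp add: Reals_cnj_iff)
  moreover have "(\<Sum>i\<in>UNIV. of_real ((cmod (w $ i))\<^sup>2)) \<noteq> (0::complex)"
  proof -
    have "(\<Sum>i\<in>UNIV. (cmod (w $ i))\<^sup>2) \<noteq> 0"
      using w(1) by (auto simp: sum_nonneg_eq_0_iff vec_eq_iff)
    then show ?thesis by (metis of_real_eq_0_iff of_real_sum)
  qed
  ultimately have "z = q / (\<Sum>i\<in>UNIV. of_real ((cmod (w $ i))\<^sup>2))" by (simp add: field_simps)
  moreover have "\<dots> \<in> \<real>" using \<open>q \<in> \<real>\<close> by (intro Reals_divide sum_in_Reals) auto
  ultimately have real: "z = complex_of_real (Re z)" by (metis of_real_Re)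
  have "mat z - cmatrix S = cmatrix (mat (Re z) - S)"
    using real by (auto simp: vec_eq_iff mat_def)
  then have "det (mat (Re z) - S) = 0"
    using \<open>det (mat z - cmatrix S) = 0\<close> by (simp add: det_cmatrix)
  then obtain v where v: "v \<noteq> 0" "(mat (Re z) - S) *v v = 0" by (rule det_eq_0_kernel)
  have "mat (Re z) *v v = Re z *\<^sub>R v"
    by (simp add: vec_eq_iff matrix_vector_mult_def mat_def if_distrib[where f="\<lambda>x. x * _"] cong: if_cong)
  with v(2) have "S *v v = Re z *\<^sub>R v" by (simp add: matrix_vector_mult_diff_rdistrib)
  with v(1) show ?thesis using real by (rule that)
qed

section \<open>The graph Laplacian\<close>

lemma laplacian_mult: "(laplacian W *v v) $ i = (\<Sum>j\<in>UNIV. W $ i $ j * (v $ i - v $ j))"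
proof -
  have "laplacian W $ i $ j * v $ j =
      (if i = j then (\<Sum>k\<in>UNIV. W $ i $ k) * v $ i else 0) - W $ i $ j * v $ j" for j
    by (simp add: laplacian_def left_diff_distrib)
  then show ?thesis
    by (simp add: matrix_vector_mult_def right_diff_distrib sum_subtractf sum_distrib_right)
qed

lemma laplacian_symmetric:
  "weighted_adjacency W \<Longrightarrow> laplacian W $ i $ j = laplacian W $ j $ i"
  by (auto simp: laplacian_def weighted_adjacency_def)

text \<open>Adding the form to its copy with exchanged indices completes the square on each edge;
  the symmetry of the weights makes both copies equal, hence the factor 2.\<close>

lemma laplacian_quadratic_form:
  assumes "weighted_adjacency W"
  shows "2 * (v \<bullet> (laplacian W *v v)) = (\<Sum>i\<in>UNIV. \<Sum>j\<in>UNIV. W $ i $ j * (v $ i - v $ j)\<^sup>2)"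
proof -
  have "v \<bullet> (laplacian W *v v) = (\<Sum>i\<in>UNIV. \<Sum>j\<in>UNIV. W $ i $ j * (v $ i - v $ j) * v $ i)"
    (is "_ = ?l")
    unfolding inner_vec_def laplacian_mult by (simp add: sum_distrib_left sum_distrib_right mult_ac)
  moreover have "?l = (\<Sum>i\<in>UNIV. \<Sum>j\<in>UNIV. W $ i $ j * (v $ j - v $ i) * v $ j)"
    using assms by (subst sum.swap) (simp add: weighted_adjacency_def)
  ultimately have "2 * (v \<bullet> (laplacian W *v v)) =
     ?l + (\<Sum>i\<in>UNIV. \<Sum>j\<in>UNIV. W $ i $ j * (v $ j - v $ i) * v $ j)" by simp
  then show ?thesis
    by (simp add: sum.distrib[symmetric] power2_eq_square algebra_simps)
qed

text \<open>Zero energy in the quadratic form makes \<open>v\<close> agree across every edge, and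
  paths carry the agreement to all vertices.\<close>

lemma laplacian_kernel_const:
  fixes W :: "real^'v^'v" and v :: "real^'v"
  assumes W: "weighted_adjacency W" "connected_graph W" and v: "laplacian W *v v = 0"
  shows "v $ i = v $ j"
proof -
  have nn: "0 \<le> W $ i $ j * (v $ i - v $ j)\<^sup>2" for i j
    using W(1) by (simp add: weighted_adjacency_def)
  have "(\<Sum>i\<in>UNIV. \<Sum>j\<in>UNIV. W $ i $ j * (v $ i - v $ j)\<^sup>2) = 0"
    using laplacian_quadratic_form[OF W(1), of v] v by simp
  then have edge: "W $ i $ j * (v $ i - v $ j)\<^sup>2 = 0" for i j
    by (simp add: sum_nonneg_eq_0_iff sum_nonneg nn)
  have "(i, j) \<in> {(i, j). j \<in> neighbours W i}\<^sup>*" using W(2) by (simp add: connected_graph_def)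
  then show ?thesis
    by (induction rule: rtrancl_induct) (use edge in \<open>force simp: neighbours_def\<close>)+
qed

text \<open>The terms \<open>W $ i $ j * (v $ i - v $ j)\<close> are antisymmetric, so the entries
  of \<open>laplacian W *v v\<close> cancel in total. Consensus controls only differences of states;
  the vanishing entry sum makes the mode along \<open>v\<close> a combination of such
  differences.\<close>

lemma laplacian_eigenvector_sum:
  fixes W :: "real^'v^'v" and v :: "real^'v"
  assumes W: "weighted_adjacency W" and v: "laplacian W *v v = l *\<^sub>R v" and l: "l \<noteq> 0"
  shows "(\<Sum>i\<in>UNIV. v $ i) = 0"
proof -
  have "l * (\<Sum>i\<in>UNIV. v $ i) = (\<Sum>i\<in>UNIV. \<Sum>j\<in>UNIV. W $ i $ j * (v $ i - v $ j))"
    using v by (simp add: sum_distrib_left laplacian_mult[symmetric])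
  also have "\<dots> = 0"
  proof -
    let ?s = "\<Sum>i\<in>UNIV. \<Sum>j\<in>UNIV. W $ i $ j * (v $ i - v $ j)"
    have "?s = (\<Sum>i\<in>UNIV. \<Sum>j\<in>UNIV. W $ i $ j * (v $ j - v $ i))"
      using W by (subst sum.swap) (simp add: weighted_adjacency_def)
    also have "\<dots> = - ?s" by (simp add: sum_negf[symmetric] algebra_simps)
    finally show ?thesis by simp
  qed
  finally show ?thesis using l by simp
qed

text \<open>When row \<open>k\<close> is expanded by linearity, every summand with
  \<open>j \<noteq> k\<close> has row \<open>j\<close> twice and vanishes.\<close>

lemma det_row_sum_all:
  fixes P :: "'a::comm_ring_1^'n^'n"
  shows "det (\<chi> i. if i = k then \<Sum>j\<in>UNIV. P $ j else P $ i) = det P"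
proof -
  have "det (\<chi> i. if i = k then \<Sum>j\<in>UNIV. P $ j else P $ i) =
    (\<Sum>j\<in>UNIV. det (\<chi> i. if i = k then P $ j else P $ i))"
    using det_linear_row_sum[of UNIV k "\<lambda>_ j. P $ j" "\<lambda>i. P $ i"] by simp
  also have "\<dots> = (\<Sum>j\<in>UNIV. if j = k then det P else 0)"
  proof (intro sum.cong refl)
    fix j
    show "det (\<chi> i. if i = k then P $ j else P $ i) = (if j = k then det P else 0)"
    proof (cases "j = k")
      case True
      then have "(\<chi> i. if i = k then P $ j else P $ i) = P" by (simp add: vec_eq_iff)
      with True show ?thesis by simp
    next
      case False
      then show ?thesis
        by (simp, intro det_identical_rows[of j k]) (auto simp: row_def vec_eq_iff)
    qed
  qed
  finally show ?thesis by simp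
qed

text \<open>The rows of \<open>z I - L\<close> sum to the row \<open>(z, \<dots>, z)\<close>, so \<open>z\<close> splits off the characteristic
  polynomial; a double root at 0 leaves a kernel vector of \<open>L\<close> with vanishing entry sum.\<close>

lemma laplacian_simple_zero:
  fixes W :: "real^'v^'v"
  assumes W: "weighted_adjacency W" "connected_graph W"
  shows "order 0 (charpoly (cmatrix (laplacian W))) \<le> 1"
proof (rule ccontr)
  assume ord: "\<not> ?thesis"
  define L where "L = laplacian W"
  define P where "P = mat [:0, 1:] - map_matrix (\<lambda>c. [:c:]) (cmatrix L)"
  obtain k :: 'v where True by simp
  \<comment> \<open>\<open>Q\<close> is \<open>P\<close> with row \<open>k\<close> replaced by the
    row sum after the factor \<open>z\<close> has been taken out; \<open>R\<close> is the value of
    \<open>Q\<close> at 0.\<close>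
  define Q where "Q = (\<chi> i. if i = k then 1 else P $ i)"
  define R where "R = (\<chi> i. if i = k then 1 else - L $ i)"
  have colsum: "(\<Sum>i\<in>UNIV. L $ i $ j) = 0" for j
  proof -
    have "(\<Sum>i\<in>UNIV. L $ i $ j) = (\<Sum>i\<in>UNIV. L $ j $ i)"
      unfolding L_def by (intro sum.cong refl laplacian_symmetric W)
    also have "\<dots> = (L *v 1) $ j" by (simp add: matrix_vector_mult_def)
    also have "\<dots> = 0" unfolding L_def laplacian_mult by simp
    finally show ?thesis .
  qed
  have "(\<Sum>i\<in>UNIV. P $ i) = [:0, 1:] *s 1"
  proof -
    have "(\<Sum>i\<in>UNIV. P $ i $ j) = [:0, 1:] - [:complex_of_real (\<Sum>i\<in>UNIV. L $ i $ j):]" for j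
      by (simp add: P_def sum_subtractf mat_def of_real_sum flip: sum_to_poly)
    then show ?thesis by (simp add: vec_eq_iff colsum)
  qed
  then have "charpoly (cmatrix L) = [:0, 1:] * det Q"
    using det_row_sum_all[of k P] det_row_mul[of k "[:0, 1:]" "\<lambda>_. 1" "\<lambda>i. P $ i"]
    by (simp add: charpoly_def P_def[symmetric] Q_def cong: if_cong)
  moreover have "[:0, 1:] ^ 2 dvd charpoly (cmatrix L)"
    using ord power_le_dvd[OF order_1[of 0 "charpoly (cmatrix L)"], of 2]
    by (simp add: L_def)
  ultimately have "[:0, 1:] * [:0, 1:] dvd [:0, 1:] * det Q" by (simp only: power2_eq_square)
  then have "[:0, 1:] dvd det Q" by (subst (asm) dvd_mult_cancel_left) simp
  then have "poly (det Q) 0 = 0" by (simp add: dvd_iff_poly_eq_0)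
  moreover have "map_matrix (\<lambda>q. poly q 0) Q = cmatrix R"
    by (auto simp: vec_eq_iff Q_def P_def R_def mat_def)
  ultimately have "det R = 0" by (simp add: poly_det det_cmatrix)
  then obtain v where v: "v \<noteq> 0" "R *v v = 0" by (rule det_eq_0_kernel)
  have comp: "(\<Sum>j\<in>UNIV. R $ i $ j * v $ j) = 0" for i
    using v(2) by (simp add: vec_eq_iff matrix_vector_mult_def)
  have sum0: "(\<Sum>j\<in>UNIV. v $ j) = 0" using comp[of k] by (simp add: R_def)
  have off: "(L *v v) $ i = 0" if "i \<noteq> k" for i
    using comp[of i] that by (simp add: R_def matrix_vector_mult_def sum_negf)
  \<comment> \<open>Row \<open>k\<close> of \<open>R\<close> does not give entry \<open>k\<close> of
    \<open>L *v v\<close>; the vanishing column sums of \<open>L\<close> recover this last equation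
    from the others.\<close>
  have "(\<Sum>i\<in>UNIV. (L *v v) $ i) = (\<Sum>j\<in>UNIV. (\<Sum>i\<in>UNIV. L $ i $ j) * v $ j)"
    unfolding matrix_vector_mult_def by (simp add: sum_distrib_right) (rule sum.swap)
  then have "(\<Sum>i\<in>UNIV. (L *v v) $ i) = 0" by (simp add: colsum)
  moreover have "(\<Sum>i\<in>UNIV. (L *v v) $ i) = (L *v v) $ k"
    using off by (subst sum.remove[of _ k]) auto
  ultimately have "L *v v = 0" using off by (metis vec_eq_iff zero_index)
  then have const: "v $ j = v $ k" for j
    unfolding L_def using laplacian_kernel_const[OF W] by blast
  have "(\<Sum>j\<in>UNIV. v $ j) = (\<Sum>j\<in>(UNIV::'v set). v $ k)" by (intro sum.cong refl const)
  with sum0 have "v $ k = 0" by simp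
  with const v(1) show False by (simp add: vec_eq_iff)
qed

section \<open>Ordered Laplacian eigenvalues and positivity of the second one\<close>

lemma laplacian_eigvals_nonneg:
  assumes W: "weighted_adjacency W" and z: "z \<in># eigvals (laplacian W)"
  shows "0 \<le> Re z"
proof -
  obtain v where v: "v \<noteq> 0" "laplacian W *v v = Re z *\<^sub>R v"
    using eigvals_symmetric[OF laplacian_symmetric[OF W] z] by metis
  have "0 \<le> 2 * (v \<bullet> (laplacian W *v v))"
    unfolding laplacian_quadratic_form[OF W]
    using W by (intro sum_nonneg) (simp add: weighted_adjacency_def)
  moreover have "0 < v \<bullet> v" using v(1) by simp
  ultimately show ?thesis unfolding v(2) by (simp add: zero_le_mult_iff)
qed

lemma laplacian_eigval_mem:
  fixes W :: "real^'v^'v"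
  assumes "1 \<le> k" "k \<le> CARD('v)"
  shows "laplacian_eigval W k \<in># image_mset Re (eigvals (laplacian W))"
proof -
  let ?l = "sorted_list_of_multiset (image_mset Re (eigvals (laplacian W)))"
  have "length ?l = CARD('v)"
    by (metis mset_sorted_list_of_multiset size_mset size_image_mset size_eigvals)
  then have "?l ! (k - 1) \<in> set ?l" using assms by (intro nth_mem) linarith
  then show ?thesis by (simp add: laplacian_eigval_def)
qed

lemma laplacian_eigval_vector:
  fixes W :: "real^'v^'v"
  assumes W: "weighted_adjacency W" and "1 \<le> k" "k \<le> CARD('v)"
  obtains v where "v \<noteq> 0" "laplacian W *v v = laplacian_eigval W k *\<^sub>R v"
proof -
  obtain z where z: "z \<in># eigvals (laplacian W)" "laplacian_eigval W k = Re z"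
    using laplacian_eigval_mem[OF assms(2,3), of W] by auto
  obtain v where "v \<noteq> 0" "laplacian W *v v = Re z *\<^sub>R v"
    using eigvals_symmetric[OF laplacian_symmetric[OF W] z(1)] by metis
  then show ?thesis using that z(2) by metis
qed

lemma laplacian_eigval_mono:
  fixes W :: "real^'v^'v"
  assumes "j \<le> k" "1 \<le> k" "k \<le> CARD('v)"
  shows "laplacian_eigval W j \<le> laplacian_eigval W k"
proof -
  let ?l = "sorted_list_of_multiset (image_mset Re (eigvals (laplacian W)))"
  have "length ?l = CARD('v)"
    by (metis mset_sorted_list_of_multiset size_mset size_image_mset size_eigvals)
  then show ?thesis
    unfolding laplacian_eigval_def using assms
    by (intro sorted_nth_mono) (auto simp: sorted_sorted_list_of_multiset)
qed

text \<open>Otherwise the two smallest entries of the sorted list are both 0, which makes 0 a double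
  root of the characteristic polynomial, contrary to its simplicity for a connected graph.\<close>

lemma laplacian_eigval_2_pos:
  fixes W :: "real^'v^'v"
  assumes W: "weighted_adjacency W" "connected_graph W" and N: "2 \<le> CARD('v)"
  shows "0 < laplacian_eigval W 2"
proof (rule ccontr)
  assume neg: "\<not> ?thesis"
  let ?E = "eigvals (laplacian W)"
  let ?l = "sorted_list_of_multiset (image_mset Re ?E)"
  have nn: "0 \<le> laplacian_eigval W k" if "1 \<le> k" "k \<le> CARD('v)" for k
    using laplacian_eigval_mem[OF that, of W] laplacian_eigvals_nonneg[OF W(1)] by auto
  have "laplacian_eigval W 1 = 0" "laplacian_eigval W 2 = 0"
    using neg nn[of 1] nn[of 2] laplacian_eigval_mono[of 1 2 W] N by auto
  then have l01: "?l ! 0 = 0" "?l ! 1 = 0" by (auto simp: laplacian_eigval_def)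
  have len: "length ?l = CARD('v)"
    by (metis mset_sorted_list_of_multiset size_mset size_image_mset size_eigvals)
  obtain t where "?l = 0 # 0 # t"
    using len N l01 by (cases ?l; cases "tl ?l") auto
  then have "mset ?l = {#0, 0#} + mset t" by simp
  then have img: "image_mset Re ?E = {#0, 0#} + mset t" by simp
  \<comment> \<open>The eigenvalues are real, so \<open>Re\<close> can be undone and the two zero
    real parts belong to the eigenvalue 0 itself.\<close>
  have "?E = image_mset complex_of_real (image_mset Re ?E)"
  proof -
    have "image_mset complex_of_real (image_mset Re ?E) = image_mset (\<lambda>z. z) ?E"
      unfolding multiset.map_comp comp_def
      by (intro image_mset_cong) (metis eigvals_symmetric[OF laplacian_symmetric[OF W(1)]])
    then show ?thesis by simp
  qed
  then have "?E = {#0, 0#} + image_mset complex_of_real (mset t)" unfolding img by simp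
  then have "2 \<le> count ?E 0" by simp
  then have "2 \<le> order 0 (charpoly (cmatrix (laplacian W)))"
    by (simp add: eigvals_def charpoly_nonzero)
  with laplacian_simple_zero[OF W] show False by simp
qed

section \<open>Rank-one updates and vanishing matrix powers\<close>

text \<open>Row \<open>k\<close> holds \<open>r\<close>, so each update of another row is an
  elementary row operation with row \<open>k\<close>.\<close>

lemma det_insert_row_updates:
  fixes T :: "'a::comm_ring_1^'n^'n"
  assumes "finite S" "k \<notin> S"
  shows "det (\<chi> i. if i = k then r else if i \<in> S then T $ i + c i *s r else T $ i) =
    det (\<chi> i. if i = k then r else T $ i)"
  using assms
proof (induction S)
  case (insert m S)
  let ?D = "\<chi> i. if i = k then r else if i \<in> S then T $ i + c i *s r else T $ i"
  have "det (\<chi> i. if i = k then r else if i \<in> insert m S then T $ i + c i *s r else T $ i) =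
    det (\<chi> i. if i = m then row m ?D + c m *s row k ?D else row i ?D)"
    using insert.hyps insert.prems by (intro arg_cong[where f=det]) (auto simp: vec_eq_iff row_def)
  also have "\<dots> = det ?D"
    using insert.prems by (intro det_row_operation) auto
  also have "\<dots> = det (\<chi> i. if i = k then r else T $ i)"
    using insert.prems by (intro insert.IH) auto
  finally show ?case .
qed (simp cong: if_cong)

text \<open>A form of the matrix determinant lemma without inverses. Rows are updated one at a time;
  when the new row is split by linearity, the part with a multiple of \<open>r\<close> in row
  \<open>k\<close> loses all earlier updates, so no power of \<open>s\<close> beyond the first
  arises.\<close>

lemma det_rank_one_update:
  fixes T :: "'a::comm_ring_1^'n^'n"
  obtains a where "\<And>s. det (\<chi> i. T $ i + (s * b i) *s r) = det T + s * a"
proof -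
  have "\<exists>a. \<forall>s. det (\<chi> i. if i \<in> S then T $ i + (s * b i) *s r else T $ i) = det T + s * a"
    if "finite S" for S using that
  proof (induction S)
    case empty
    show ?case by (intro exI[of _ 0]) simp
  next
    case (insert k S)
    from insert.IH obtain a where a: "\<And>s. det (\<chi> i. if i \<in> S then T $ i + (s * b i) *s r else T $ i) = det T + s * a"
      by blast
    have "det (\<chi> i. if i \<in> insert k S then T $ i + (s * b i) *s r else T $ i) =
      det T + s * (a + b k * det (\<chi> i. if i = k then r else T $ i))" for s
    proof -
      let ?c = "\<lambda>i. if i \<in> S then T $ i + (s * b i) *s r else T $ i"
      have "det (\<chi> i. if i \<in> insert k S then T $ i + (s * b i) *s r else T $ i) =
        det (\<chi> i. if i = k then T $ i + (s * b i) *s r else ?c i)"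
        by (rule arg_cong[where f=det]) (auto simp: vec_eq_iff)
      also have "\<dots> = det (\<chi> i. if i = k then T $ i else ?c i) +
          det (\<chi> i. if i = k then (s * b i) *s r else ?c i)"
        by (rule det_row_add)
      also have "(\<chi> i. if i = k then T $ i else ?c i) = (\<chi> i. ?c i)"
        using insert.hyps by (auto simp: vec_eq_iff)
      also have "det (\<chi> i. if i = k then (s * b i) *s r else ?c i) =
          (s * b k) * det (\<chi> i. if i = k then r else ?c i)"
        using det_row_mul[of k "s * b k" "\<lambda>_. r" ?c] by (simp cong: if_cong)
      also have "det (\<chi> i. if i = k then r else ?c i) = det (\<chi> i. if i = k then r else T $ i)"
        using det_insert_row_updates[OF insert.hyps] .
      finally show ?thesis by (simp add: a algebra_simps)
    qed
    then show ?case by blast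
  qed
  from this[of UNIV] that show ?thesis by auto
qed

text \<open>For positive \<open>D\<close>, the constraint at \<open>l\<close> gives
  \<open>D - 1 < l * t\<close> and the one at \<open>h\<close> gives \<open>h * t < D + 1\<close>.
  Eliminating \<open>t\<close> leaves \<open>h * (D - 1) < l * (D + 1)\<close>. A negative
  \<open>D\<close> is treated by changing the signs of \<open>D\<close> and
  \<open>t\<close>.\<close>

lemma ratio_bound:
  fixes t :: real
  assumes D: "1 \<le> \<bar>D\<bar>" and l: "0 < l" "l < h" and bd: "\<bar>D - l * t\<bar> < 1" "\<bar>D - h * t\<bar> < 1"
  shows "D\<^sup>2 < ((1 + l / h) / (1 - l / h))\<^sup>2"
proof -
  have pos: "E < (h + l) / (h - l)" if E: "1 \<le> E" "\<bar>E - l * s\<bar> < 1" "\<bar>E - h * s\<bar> < 1" for E s :: real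
  proof -
    have "h * (E - 1) < h * (l * s)" using E l by (intro mult_strict_left_mono) auto
    also have "\<dots> = l * (h * s)" by simp
    also have "\<dots> < l * (E + 1)" using E l by (intro mult_strict_left_mono) auto
    finally show ?thesis using l by (simp add: field_simps)
  qed
  have "\<bar>D\<bar> < (h + l) / (h - l)"
  proof (cases "0 \<le> D")
    case True
    then show ?thesis using pos[of D t] D bd by simp
  next
    case False
    then show ?thesis using pos[of "- D" "- t"] D bd by auto
  qed
  also have "(h + l) / (h - l) = (1 + l / h) / (1 - l / h)"
    using l by (simp add: field_simps)
  finally have "\<bar>D\<bar>\<^sup>2 < ((1 + l / h) / (1 - l / h))\<^sup>2"
    by (intro power_strict_mono) auto
  then show ?thesis by simp
qed

section \<open>Vanishing matrix powers\<close>

lemma det_mat_pow: "det (mat_pow T k) = det T ^ k"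
  for T :: "'a::comm_ring_1^'n^'n"
  by (induction k) (auto simp: det_mul)

lemma tendsto_det:
  fixes T :: "nat \<Rightarrow> real^'n^'n"
  assumes "\<And>i j. (\<lambda>k. T k $ i $ j) \<longlonglongrightarrow> S $ i $ j"
  shows "(\<lambda>k. det (T k)) \<longlonglongrightarrow> det S"
  unfolding det_def by (intro tendsto_intros assms)

text \<open>Testing with basis vectors, every entry of \<open>mat_pow F k ** T\<close> tends to 0,
  hence so does \<open>det F ^ k * det T\<close>; dividing by \<open>det T\<close> leaves powers of
  \<open>det F\<close> that tend to 0.\<close>

lemma abs_det_less_1:
  fixes F T :: "real^'n^'n"
  assumes "\<And>e. (\<lambda>k. mat_pow F k *v (T *v e)) \<longlonglongrightarrow> 0" and T: "det T \<noteq> 0"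
  shows "\<bar>det F\<bar> < 1"
proof (rule ccontr)
  assume ge: "\<not> ?thesis"
  have "(\<lambda>k. (mat_pow F k ** T) $ i $ j) \<longlonglongrightarrow> (mat 0 :: real^'n^'n) $ i $ j" for i j
  proof -
    have "(mat_pow F k ** T) $ i $ j = (mat_pow F k *v (T *v axis j 1)) $ i" for k
      unfolding matrix_vector_mul_assoc matrix_vector_mult_basis by (simp add: column_def matrix_matrix_mult_def matrix_vector_mult_def)
    then show ?thesis using tendsto_vec_nth[OF assms(1)[of "axis j 1"], of i]
      by (simp add: mat_def)
  qed
  then have "(\<lambda>k. det (mat_pow F k ** T)) \<longlonglongrightarrow> det (mat 0 :: real^'n^'n)" by (rule tendsto_det)
  then have "(\<lambda>k. det F ^ k * det T) \<longlonglongrightarrow> 0"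
    unfolding det_mul det_mat_pow det_0 .
  then have "(\<lambda>k. det F ^ k * det T / det T) \<longlonglongrightarrow> 0 / det T" by (intro tendsto_divide T) auto
  then have "(\<lambda>k. \<bar>det F ^ k\<bar>) \<longlonglongrightarrow> 0" using T by (simp add: tendsto_rabs_zero_iff)
  moreover have "1 \<le> \<bar>det F ^ k\<bar>" for k using ge by (simp add: power_abs one_le_power)
  ultimately have "(1::real) \<le> 0" by (intro LIMSEQ_le_const) auto
  then show False by simp
qed

section \<open>The mean closed loop\<close>

text \<open>Variation of constants for the loop with the random factor replaced by the constant
  \<open>\<mu>\<close>. For \<open>e = d\<close>, started at time \<open>k - d\<close>, it is the
  predictor formula, so the prediction is exact.\<close>

lemma dynamics_iterate:
  assumes "dynamics A B d (\<lambda>_. \<mu>) X U"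
  shows "X (n + e) i = mat_pow A e *v X n i +
    \<mu> *\<^sub>R (\<Sum>j = 1..e. mat_pow A (j - 1) *v (B *v U (int (n + e) - int d - int j) i))"
proof (induction e)
  case (Suc e)
  let ?f = "\<lambda>e j. mat_pow A (j - 1) *v (B *v U (int (n + e) - int d - int j) i)"
  \<comment> \<open>The term \<open>j = 1\<close> is the newest input; the remaining terms give up
    one factor \<open>A\<close> and form the sum of the previous step.\<close>
  have "(\<Sum>j = 1..Suc e. ?f (Suc e) j) = B *v U (int (n + e) - int d) i + A *v (\<Sum>j = 1..e. ?f e j)"
    unfolding One_nat_def sum.atLeast1_atMost_eq sum.lessThan_Suc_shift
    by (simp add: matrix_vector_mul_assoc[symmetric] linear_sum[OF matrix_vector_mul_linear] algebra_simps)
  moreover have "X (n + Suc e) i = A *v X (n + e) i + \<mu> *\<^sub>R (B *v U (int (n + e) - int d) i)"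
    using assms by (simp add: dynamics_def)
  ultimately show ?case unfolding Suc.IH
    by (simp add: matrix_vector_right_distrib matrix_vector_mult_scaleR scaleR_right_distrib
        matrix_vector_mul_assoc[symmetric])
qed simp

lemma prediction_mean_exact:
  assumes "dynamics A B d (\<lambda>_. \<mu>) X U" and "d \<le> k"
  shows "prediction A B \<mu> d X U k i = X k i"
  using dynamics_iterate[OF assms(1), of "k - d" d i] assms(2) by (simp add: prediction_def)

lemma matrix_diff_scaleR_mult: "(T - s *\<^sub>R S) *v x = T *v x - s *\<^sub>R (S *v x)"
  for T S :: "real^'n^'m"
  by (simp add: matrix_vector_mult_diff_rdistrib scaleR_matrix_vector_assoc)

text \<open>Exact prediction turns the protocol into undelayed state feedback. Projected on
  \<open>v\<close>, the coupling terms become \<open>- l\<close> times the projected state, so each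
  mode evolves on its own.\<close>

lemma mean_mode_step:
  assumes W: "weighted_adjacency W" and v: "laplacian W *v v = l *\<^sub>R v"
    and dyn: "dynamics A B d (\<lambda>_. \<mu>) X U" and prot: "predictor_protocol A B \<mu> d W K X U"
    and k: "d \<le> k"
  shows "(\<Sum>i\<in>UNIV. v $ i *\<^sub>R X (Suc k) i) =
    (A - (\<mu> * l) *\<^sub>R (B ** K)) *v (\<Sum>i\<in>UNIV. v $ i *\<^sub>R X k i)"
proof -
  define y where "y = (\<Sum>i\<in>UNIV. v $ i *\<^sub>R X k i)"
  define c where "c i = (\<Sum>j\<in>UNIV. W $ i $ j *\<^sub>R (X k j - X k i))" for i
  have "U (int k - int d) i = K *v c i" for i
  proof -
    have "(\<Sum>j\<in>neighbours W i. W $ i $ j *\<^sub>R (X k j - X k i)) = c i"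
      unfolding c_def using W
      by (intro sum.mono_neutral_left) (auto simp: neighbours_def weighted_adjacency_def order_less_le)
    then show ?thesis
      using prot k prediction_mean_exact[OF dyn k] by (simp add: predictor_protocol_def)
  qed
  then have step: "X (Suc k) i = A *v X k i + \<mu> *\<^sub>R ((B ** K) *v c i)" for i
    using dyn by (simp add: dynamics_def matrix_vector_mul_assoc[symmetric])
  have "(\<Sum>i\<in>UNIV. v $ i *\<^sub>R c i) = - l *\<^sub>R y"
  proof -
    have "(\<Sum>i\<in>UNIV. v $ i *\<^sub>R c i) =
      (\<Sum>i\<in>UNIV. \<Sum>j\<in>UNIV. (v $ i * W $ i $ j) *\<^sub>R X k j) - (\<Sum>i\<in>UNIV. \<Sum>j\<in>UNIV. (v $ i * W $ i $ j) *\<^sub>R X k i)"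
      by (simp add: c_def scaleR_sum_right scaleR_diff_right sum_subtractf)
    \<comment> \<open>The index swap brings both sums to coefficients of \<open>X k i\<close>, which
      combine to \<open>- (laplacian W *v v) $ i\<close>.\<close>
    also have "(\<Sum>i\<in>UNIV. \<Sum>j\<in>UNIV. (v $ i * W $ i $ j) *\<^sub>R X k j) =
      (\<Sum>i\<in>UNIV. \<Sum>j\<in>UNIV. (v $ j * W $ i $ j) *\<^sub>R X k i)"
      using W by (subst sum.swap) (simp add: weighted_adjacency_def)
    also have "\<dots> - (\<Sum>i\<in>UNIV. \<Sum>j\<in>UNIV. (v $ i * W $ i $ j) *\<^sub>R X k i) =
      (\<Sum>i\<in>UNIV. - ((laplacian W *v v) $ i) *\<^sub>R X k i)"
      unfolding laplacian_mult
      by (simp add: sum_subtractf[symmetric] scaleR_diff_left[symmetric] scaleR_sum_left[symmetric]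
          sum_negf[symmetric] algebra_simps)
    finally show ?thesis by (simp add: v y_def scaleR_sum_right sum_negf)
  qed
  then have "(\<Sum>i\<in>UNIV. v $ i *\<^sub>R ((B ** K) *v c i)) = - l *\<^sub>R ((B ** K) *v y)"
    by (simp add: matrix_vector_mult_scaleR[symmetric] linear_sum[OF matrix_vector_mul_linear, symmetric])
  moreover have "(\<Sum>i\<in>UNIV. v $ i *\<^sub>R (A *v X k i)) = A *v y"
    by (simp add: y_def matrix_vector_mult_scaleR[symmetric] linear_sum[OF matrix_vector_mul_linear, symmetric])
  moreover have "(\<Sum>i\<in>UNIV. v $ i *\<^sub>R X (Suc k) i) =
      (\<Sum>i\<in>UNIV. v $ i *\<^sub>R (A *v X k i)) + \<mu> *\<^sub>R (\<Sum>i\<in>UNIV. v $ i *\<^sub>R ((B ** K) *v c i))"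
    by (simp add: step scaleR_right_distrib sum.distrib scaleR_sum_right mult.commute)
  ultimately show ?thesis
    by (simp add: y_def[symmetric] matrix_diff_scaleR_mult)
qed

section \<open>Linear functions of past channel states\<close>

text \<open>Products over sets of distinct indices suffice, since each step multiplies by the new factor
  \<open>\<gamma> k\<close> only once; this makes all expectations explicit.\<close>

inductive adapted :: "(nat \<Rightarrow> 'w \<Rightarrow> real) \<Rightarrow> nat \<Rightarrow> ('w \<Rightarrow> 'b::real_vector) \<Rightarrow> bool"
  for \<gamma> k where
  monomial: "S \<subseteq> {..<k} \<Longrightarrow> adapted \<gamma> k (\<lambda>\<omega>. (\<Prod>j\<in>S. \<gamma> j \<omega>) *\<^sub>R c)"
| add: "adapted \<gamma> k f \<Longrightarrow> adapted \<gamma> k g \<Longrightarrow> adapted \<gamma> k (\<lambda>\<omega>. f \<omega> + g \<omega>)"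

lemma adapted_const: "adapted \<gamma> k (\<lambda>_. c)"
  using adapted.monomial[of "{}" k \<gamma> c] by simp

lemma adapted_linear:
  assumes "linear L" "adapted \<gamma> k f"
  shows "adapted \<gamma> k (\<lambda>\<omega>. L (f \<omega>))"
  using assms(2)
  by induction (auto simp: linear_add[OF assms(1)] linear_scale[OF assms(1)] intro: adapted.intros)

lemma adapted_scaleR: "adapted \<gamma> k f \<Longrightarrow> adapted \<gamma> k (\<lambda>\<omega>. c *\<^sub>R f \<omega>)"
  by (rule adapted_linear[OF linear_scale_self])

lemma adapted_matrix_vector_mult:
  fixes T :: "real^'n^'m"
  shows "adapted \<gamma> k f \<Longrightarrow> adapted \<gamma> k (\<lambda>\<omega>. T *v f \<omega>)"
  by (rule adapted_linear[OF matrix_vector_mul_linear])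

lemma adapted_diff:
  assumes "adapted \<gamma> k f" "adapted \<gamma> k g"
  shows "adapted \<gamma> k (\<lambda>\<omega>. f \<omega> - g \<omega>)"
  using adapted.add[OF assms(1) adapted_scaleR[OF assms(2), of "-1"]] by simp

lemma adapted_sum:
  assumes "\<And>i. i \<in> I \<Longrightarrow> adapted \<gamma> k (f i)"
  shows "adapted \<gamma> k (\<lambda>\<omega>. \<Sum>i\<in>I. f i \<omega>)"
  using assms
  by (induction I rule: infinite_finite_induct) (auto intro: adapted_const adapted.add)

lemma adapted_mono:
  assumes "adapted \<gamma> k f" "k \<le> k'"
  shows "adapted \<gamma> k' f"
  using assms(1)
proof induction
  case (monomial S c)
  then show ?case using assms(2) by (intro adapted.monomial) auto
qed (rule adapted.add)

lemma adapted_channel: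
  assumes "adapted \<gamma> k f"
  shows "adapted \<gamma> (Suc k) (\<lambda>\<omega>. \<gamma> k \<omega> *\<^sub>R f \<omega>)"
  using assms
proof induction
  case (monomial S c)
  then have "finite S" "k \<notin> S" by (auto intro: finite_subset)
  then have "(\<lambda>\<omega>. \<gamma> k \<omega> *\<^sub>R (\<Prod>j\<in>S. \<gamma> j \<omega>) *\<^sub>R c) = (\<lambda>\<omega>. (\<Prod>j\<in>insert k S. \<gamma> j \<omega>) *\<^sub>R c)"
    by simp
  moreover have "adapted \<gamma> (Suc k) \<dots>" using monomial by (intro adapted.monomial) auto
  ultimately show ?case by simp
next
  case (add f g)
  then show ?case by (simp add: scaleR_right_distrib adapted.add)
qed

section \<open>Moments of the channel process and of adapted functions\<close>

lemma iid_bernoulli_AE: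
  assumes "prob_space M" "iid_bernoulli M \<gamma> p"
  shows "AE \<omega> in M. \<gamma> k \<omega> = 0 \<or> \<gamma> k \<omega> = 1"
proof -
  interpret prob_space M by fact
  have [measurable]: "\<gamma> k \<in> borel_measurable M"
    using assms(2) by (auto simp: iid_bernoulli_def indep_vars_def)
  have "prob {\<omega> \<in> space M. \<gamma> k \<omega> = 0 \<or> \<gamma> k \<omega> = 1} =
      prob ({\<omega> \<in> space M. \<gamma> k \<omega> = 0} \<union> {\<omega> \<in> space M. \<gamma> k \<omega> = 1})"
    by (rule arg_cong[where f = prob]) auto
  also have "\<dots> = prob {\<omega> \<in> space M. \<gamma> k \<omega> = 0} + prob {\<omega> \<in> space M. \<gamma> k \<omega> = 1}"
    by (intro finite_measure_Union) auto
  also have "\<dots> = 1" using assms(2) by (simp add: iid_bernoulli_def)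
  finally show ?thesis by (subst (asm) prob_Collect_eq_1) auto
qed

text \<open>Almost surely \<open>\<gamma> k\<close> is the indicator of the event that it equals
  1.\<close>

lemma iid_bernoulli_mean:
  assumes "prob_space M" "iid_bernoulli M \<gamma> p"
  shows "integrable M (\<gamma> k)" "(\<integral>\<omega>. \<gamma> k \<omega> \<partial>M) = 1 - p"
proof -
  interpret prob_space M by fact
  have meas [measurable]: "\<gamma> k \<in> borel_measurable M"
    using assms(2) by (auto simp: iid_bernoulli_def indep_vars_def)
  let ?E = "{\<omega> \<in> space M. \<gamma> k \<omega> = 1}"
  have "AE \<omega> in M. \<gamma> k \<omega> = indicator ?E \<omega>"
    using iid_bernoulli_AE[OF assms, of k] AE_space by eventually_elim auto
  note ae = this
  have int: "integrable M (indicator ?E :: _ \<Rightarrow> real)"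
    by (intro integrable_real_indicator) (auto simp: emeasure_eq_measure)
  show "integrable M (\<gamma> k)"
    by (rule integrable_cong_AE_imp[OF int meas]) (use ae in eventually_elim, rule sym)
  have "(\<integral>\<omega>. \<gamma> k \<omega> \<partial>M) = (\<integral>\<omega>. indicator ?E \<omega> \<partial>M)"
    by (rule integral_cong_AE[OF meas _ ae]) measurable
  also have "\<dots> = prob ?E" by simp
  finally show "(\<integral>\<omega>. \<gamma> k \<omega> \<partial>M) = 1 - p" using assms(2) by (simp add: iid_bernoulli_def)
qed

lemma iid_bernoulli_prod:
  assumes "prob_space M" "iid_bernoulli M \<gamma> p" "finite S"
  shows "integrable M (\<lambda>\<omega>. \<Prod>j\<in>S. \<gamma> j \<omega>)" "(\<integral>\<omega>. (\<Prod>j\<in>S. \<gamma> j \<omega>) \<partial>M) = (1 - p) ^ card S"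
proof -
  interpret prob_space M by fact
  have ind: "indep_vars (\<lambda>_. borel) \<gamma> S"
    using assms(2) by (auto simp: iid_bernoulli_def intro: indep_vars_subset)
  note mean = iid_bernoulli_mean[OF assms(1,2)]
  show "integrable M (\<lambda>\<omega>. \<Prod>j\<in>S. \<gamma> j \<omega>)"
    by (rule indep_vars_integrable[OF assms(3) ind mean(1)])
  show "(\<integral>\<omega>. (\<Prod>j\<in>S. \<gamma> j \<omega>) \<partial>M) = (1 - p) ^ card S"
    using indep_vars_lebesgue_integral[OF assms(3) ind mean(1)] by (simp add: mean(2))
qed

lemma adapted_integrable:
  fixes f :: "'w \<Rightarrow> 'b::{banach, second_countable_topology}"
  assumes "prob_space M" "iid_bernoulli M \<gamma> p" "adapted \<gamma> k f"
  shows "integrable M f"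
  using assms(3)
proof induction
  case (monomial S c)
  then show ?case
    by (intro integrable_scaleR_left iid_bernoulli_prod[OF assms(1,2)]) (auto intro: finite_subset)
qed simp

text \<open>The factor \<open>\<gamma> k\<close> is independent of the earlier channel states in
  \<open>f\<close>. On monomials, passing from \<open>S\<close> to \<open>insert k S\<close> raises
  the mean \<open>(1 - p) ^ card S\<close> by one power; linearity does the rest.\<close>

lemma adapted_channel_mean:
  fixes f :: "'w \<Rightarrow> 'b::{banach, second_countable_topology}"
  assumes M: "prob_space M" "iid_bernoulli M \<gamma> p" and f: "adapted \<gamma> k f"
  shows "(\<integral>\<omega>. \<gamma> k \<omega> *\<^sub>R f \<omega> \<partial>M) = (1 - p) *\<^sub>R (\<integral>\<omega>. f \<omega> \<partial>M)"
  using f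
proof induction
  case (monomial S c)
  then have S: "finite S" "k \<notin> S" by (auto intro: finite_subset)
  then have "(\<integral>\<omega>. \<gamma> k \<omega> *\<^sub>R (\<Prod>j\<in>S. \<gamma> j \<omega>) *\<^sub>R c \<partial>M) = (\<integral>\<omega>. (\<Prod>j\<in>insert k S. \<gamma> j \<omega>) *\<^sub>R c \<partial>M)"
    by simp
  also have "\<dots> = (\<integral>\<omega>. (\<Prod>j\<in>insert k S. \<gamma> j \<omega>) \<partial>M) *\<^sub>R c"
    using S by (intro integral_scaleR_left iid_bernoulli_prod[OF M]) simp
  also have "\<dots> = (1 - p) *\<^sub>R (\<integral>\<omega>. (\<Prod>j\<in>S. \<gamma> j \<omega>) \<partial>M) *\<^sub>R c"
    using S by (subst (1 2) iid_bernoulli_prod[OF M]) auto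
  also have "(\<integral>\<omega>. (\<Prod>j\<in>S. \<gamma> j \<omega>) \<partial>M) *\<^sub>R c = (\<integral>\<omega>. (\<Prod>j\<in>S. \<gamma> j \<omega>) *\<^sub>R c \<partial>M)"
    using S by (intro integral_scaleR_left[symmetric] iid_bernoulli_prod[OF M])
  finally show ?case .
next
  case (add f g)
  note int = adapted_integrable[OF M]
  have "(\<integral>\<omega>. \<gamma> k \<omega> *\<^sub>R (f \<omega> + g \<omega>) \<partial>M) = (\<integral>\<omega>. \<gamma> k \<omega> *\<^sub>R f \<omega> \<partial>M) + (\<integral>\<omega>. \<gamma> k \<omega> *\<^sub>R g \<omega> \<partial>M)"
    unfolding scaleR_right_distrib
    by (intro Bochner_Integration.integral_add int[OF adapted_channel] add.hyps)
  then show ?case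
    using int[OF add.hyps(1)] int[OF add.hyps(2)] by (simp add: add.IH scaleR_right_distrib)
qed

text \<open>Almost surely all channel states are 0 or 1 simultaneously, so a monomial is bounded by
  the norm of its coefficient. The bound supplies the square integrability behind the variance
  argument below.\<close>

lemma adapted_bounded:
  fixes f :: "'w \<Rightarrow> 'b::real_normed_vector"
  assumes M: "prob_space M" "iid_bernoulli M \<gamma> p" and f: "adapted \<gamma> k f"
  shows "\<exists>C. AE \<omega> in M. norm (f \<omega>) \<le> C"
  using f
proof induction
  case (monomial S c)
  have "AE \<omega> in M. \<forall>j. \<gamma> j \<omega> = 0 \<or> \<gamma> j \<omega> = 1"
    using iid_bernoulli_AE[OF M] by (simp add: AE_all_countable)
  then have "AE \<omega> in M. norm ((\<Prod>j\<in>S. \<gamma> j \<omega>) *\<^sub>R c) \<le> norm c"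
  proof eventually_elim
    case (elim \<omega>)
    have "\<bar>\<gamma> j \<omega>\<bar> \<le> 1" for j using spec[OF elim, of j] by auto
    then have "\<bar>\<Prod>j\<in>S. \<gamma> j \<omega>\<bar> \<le> 1" unfolding abs_prod by (intro prod_le_1) auto
    then show ?case using mult_right_mono[of _ 1 "norm c"] by simp
  qed
  then show ?case by blast
next
  case (add f g)
  then obtain C D where "AE \<omega> in M. norm (f \<omega>) \<le> C" "AE \<omega> in M. norm (g \<omega>) \<le> D" by blast
  then have "AE \<omega> in M. norm (f \<omega> + g \<omega>) \<le> C + D"
    by eventually_elim (meson add_mono norm_triangle_ineq order_trans)
  then show ?case by blast
qed

text \<open>The norm of the mean is at most the mean of the norm, whose square is at most the second
  moment since a variance is nonnegative. This carries mean-square consensus over to the mean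
  trajectories.\<close>

lemma adapted_norm_mean_le:
  fixes f :: "'w \<Rightarrow> 'b::euclidean_space"
  assumes M: "prob_space M" "iid_bernoulli M \<gamma> p" and f: "adapted \<gamma> k f"
  shows "(norm (\<integral>\<omega>. f \<omega> \<partial>M))\<^sup>2 \<le> (\<integral>\<omega>. (norm (f \<omega>))\<^sup>2 \<partial>M)"
proof -
  interpret prob_space M by fact
  have int: "integrable M f" by (rule adapted_integrable[OF M f])
  then have [measurable]: "f \<in> borel_measurable M" by simp
  obtain C where C: "AE \<omega> in M. norm (f \<omega>) \<le> C" using adapted_bounded[OF M f] by blast
  then have "AE \<omega> in M. norm ((norm (f \<omega>))\<^sup>2) \<le> C\<^sup>2"
    by eventually_elim (simp add: power_mono)
  then have int2: "integrable M (\<lambda>\<omega>. (norm (f \<omega>))\<^sup>2)"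
    by (intro integrable_const_bound[of _ "C\<^sup>2"]) auto
  have "norm (\<integral>\<omega>. f \<omega> \<partial>M) \<le> (\<integral>\<omega>. norm (f \<omega>) \<partial>M)"
    by (rule integral_norm_bound)
  then have "(norm (\<integral>\<omega>. f \<omega> \<partial>M))\<^sup>2 \<le> (\<integral>\<omega>. norm (f \<omega>) \<partial>M)\<^sup>2"
    by (intro power_mono) auto
  also have "\<dots> \<le> (\<integral>\<omega>. (norm (f \<omega>))\<^sup>2 \<partial>M)"
    using variance_positive[of "\<lambda>\<omega>. norm (f \<omega>)"] variance_eq[of "\<lambda>\<omega>. norm (f \<omega>)"] int int2 by simp
  finally show ?thesis .
qed

section \<open>Closed-loop trajectories\<close>

text \<open>The second component buffers the past inputs: its entry \<open>j\<close> after \<open>k\<close> steps is the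
  input at time \<open>k - 1 - j\<close>. Inputs at negative times are 0.\<close>

primrec closed_loop ::
  "real^'n^'n \<Rightarrow> real^'m^'n \<Rightarrow> real \<Rightarrow> nat \<Rightarrow> real^'v^'v \<Rightarrow> real^'n^'m \<Rightarrow> ('v \<Rightarrow> real^'n) \<Rightarrow>
   (nat \<Rightarrow> real) \<Rightarrow> nat \<Rightarrow> ('v \<Rightarrow> real^'n) \<times> (nat \<Rightarrow> 'v \<Rightarrow> real^'m)" where
  "closed_loop A B \<mu> d W K x0 g 0 = (x0, \<lambda>_ _. 0)"
| "closed_loop A B \<mu> d W K x0 g (Suc k) =
    (let (x, b) = closed_loop A B \<mu> d W K x0 g k;
         z = (\<lambda>i. mat_pow A d *v x i + \<mu> *\<^sub>R (\<Sum>j = 1..d. mat_pow A (j - 1) *v (B *v b (j - 1) i)));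
         b' = case_nat (\<lambda>i. K *v (\<Sum>j\<in>neighbours W i. W $ i $ j *\<^sub>R (z j - z i))) b
     in (\<lambda>i. A *v x i + g k *\<^sub>R (B *v b' d i), b'))"

definition loop_state where
  "loop_state A B \<mu> d W K x0 g k = fst (closed_loop A B \<mu> d W K x0 g k)"

definition loop_input :: "real^'n^'n \<Rightarrow> real^'m^'n \<Rightarrow> real \<Rightarrow> nat \<Rightarrow> real^'v^'v \<Rightarrow> real^'n^'m \<Rightarrow>
    ('v \<Rightarrow> real^'n) \<Rightarrow> (nat \<Rightarrow> real) \<Rightarrow> int \<Rightarrow> 'v \<Rightarrow> real^'m" where
  "loop_input A B \<mu> d W K x0 g t =
    (if t < 0 then \<lambda>_. 0 else snd (closed_loop A B \<mu> d W K x0 g (Suc (nat t))) 0)"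

lemma closed_loop_buffer:
  "snd (closed_loop A B \<mu> d W K x0 g k) j = loop_input A B \<mu> d W K x0 g (int k - 1 - int j)"
proof (induction k arbitrary: j)
  case 0
  show ?case by (simp add: loop_input_def)
next
  case (Suc k)
  show ?case
  proof (cases j)
    case 0
    then show ?thesis by (simp add: loop_input_def del: closed_loop.simps)
  next
    case (Suc i)
    have "snd (closed_loop A B \<mu> d W K x0 g (Suc k)) j = snd (closed_loop A B \<mu> d W K x0 g k) i"
      by (simp add: Suc Let_def split: prod.split)
    moreover have "int (Suc k) - 1 - int j = int k - 1 - int i" by (simp add: Suc)
    ultimately show ?thesis by (metis Suc.IH)
  qed
qed

lemma closed_loop_dynamics:
  "dynamics A B d g (loop_state A B \<mu> d W K x0 g) (loop_input A B \<mu> d W K x0 g)"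
proof -
  \<comment> \<open>The buffer already includes the input of the current step, so the delayed input
    \<open>u (k - d)\<close> is its entry \<open>d\<close> after \<open>Suc k\<close> steps.\<close>
  have "loop_state A B \<mu> d W K x0 g (k + 1) i = A *v loop_state A B \<mu> d W K x0 g k i +
      g k *\<^sub>R (B *v snd (closed_loop A B \<mu> d W K x0 g (Suc k)) d i)" for k i
    by (simp add: loop_state_def Let_def split: prod.split)
  then show ?thesis
    unfolding dynamics_def closed_loop_buffer by simp
qed

text \<open>The input at time \<open>k - d\<close> is computed from the state and the buffer after
  \<open>k - d\<close> steps; buffer entry \<open>j - 1\<close> is the input at time
  \<open>k - d - j\<close>, as the prediction requires.\<close>

lemma loop_input_feedback:
  assumes "d \<le> k"
  shows "loop_input A B \<mu> d W K x0 g (int k - int d) i =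
    K *v (\<Sum>j\<in>neighbours W i. W $ i $ j *\<^sub>R
      (prediction A B \<mu> d (loop_state A B \<mu> d W K x0 g) (loop_input A B \<mu> d W K x0 g) k j -
       prediction A B \<mu> d (loop_state A B \<mu> d W K x0 g) (loop_input A B \<mu> d W K x0 g) k i))"
proof -
  let ?c = "closed_loop A B \<mu> d W K x0 g (k - d)"
  define z where "z i = mat_pow A d *v fst ?c i +
      \<mu> *\<^sub>R (\<Sum>j = 1..d. mat_pow A (j - 1) *v (B *v snd ?c (j - 1) i))" for i
  have "z i = prediction A B \<mu> d (loop_state A B \<mu> d W K x0 g) (loop_input A B \<mu> d W K x0 g) k i" for i
    unfolding z_def prediction_def loop_state_def closed_loop_buffer
    using assms by (intro arg_cong2[where f="(+)"] arg_cong2[where f="scaleR"] sum.cong refl)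
      (auto simp: of_nat_diff algebra_simps)
  moreover have "loop_input A B \<mu> d W K x0 g (int k - int d) i =
      K *v (\<Sum>j\<in>neighbours W i. W $ i $ j *\<^sub>R (z j - z i))"
  proof -
    have "nat (int k - int d) = k - d" by simp
    then show ?thesis using assms
      by (simp add: loop_input_def z_def Let_def case_prod_unfold)
  qed
  ultimately show ?thesis by simp
qed

lemma closed_loop_protocol:
  "predictor_protocol A B \<mu> d W K (loop_state A B \<mu> d W K x0 g) (loop_input A B \<mu> d W K x0 g)"
  unfolding predictor_protocol_def using loop_input_feedback by blast

text \<open>The third conjunct gains one step: the newest input is formed before channel state
  \<open>k\<close>, which enters only the state update. Hence \<open>\<gamma> k\<close> is
  independent of the input that it multiplies.\<close>

lemma closed_loop_adapted:
  fixes \<gamma> :: "nat \<Rightarrow> 'w \<Rightarrow> real" and A :: "real^'n^'n" and B :: "real^'m^'n" and W :: "real^'v^'v"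
  shows "(\<forall>i. adapted \<gamma> k (\<lambda>\<omega>. fst (closed_loop A B \<mu> d W K x0 (\<lambda>k. \<gamma> k \<omega>) k) i)) \<and>
    (\<forall>j i. adapted \<gamma> k (\<lambda>\<omega>. snd (closed_loop A B \<mu> d W K x0 (\<lambda>k. \<gamma> k \<omega>) k) j i)) \<and>
    (\<forall>j i. adapted \<gamma> k (\<lambda>\<omega>. snd (closed_loop A B \<mu> d W K x0 (\<lambda>k. \<gamma> k \<omega>) (Suc k)) j i))"
proof -
  define S where "S = (\<lambda>k \<omega>. closed_loop A B \<mu> d W K x0 (\<lambda>k. \<gamma> k \<omega>) k)"
  note mv = adapted_matrix_vector_mult
  note intros = mv adapted.add adapted_diff adapted_sum adapted_scaleR
  have input: "adapted \<gamma> k (\<lambda>\<omega>. snd (S (Suc k) \<omega>) j i)"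
    if "\<And>i. adapted \<gamma> k (\<lambda>\<omega>. fst (S k \<omega>) i)" "\<And>j i. adapted \<gamma> k (\<lambda>\<omega>. snd (S k \<omega>) j i)" for k j i
    using that
    by (cases j) (auto simp: S_def Let_def case_prod_unfold intro!: intros)
  have state: "adapted \<gamma> (Suc k) (\<lambda>\<omega>. fst (S (Suc k) \<omega>) i)"
    if "\<And>i. adapted \<gamma> k (\<lambda>\<omega>. fst (S k \<omega>) i)" "\<And>j i. adapted \<gamma> k (\<lambda>\<omega>. snd (S (Suc k) \<omega>) j i)" for k i
  proof -
    have "(\<lambda>\<omega>. fst (S (Suc k) \<omega>) i) =
        (\<lambda>\<omega>. A *v fst (S k \<omega>) i + \<gamma> k \<omega> *\<^sub>R (B *v snd (S (Suc k) \<omega>) d i))"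
      by (simp add: S_def Let_def case_prod_unfold)
    moreover have "adapted \<gamma> (Suc k) \<dots>"
      by (intro adapted.add adapted_channel mv that adapted_mono[OF mv[OF that(1)]]) simp
    ultimately show ?thesis by simp
  qed
  have "(\<forall>i. adapted \<gamma> k (\<lambda>\<omega>. fst (S k \<omega>) i)) \<and> (\<forall>j i. adapted \<gamma> k (\<lambda>\<omega>. snd (S k \<omega>) j i)) \<and>
    (\<forall>j i. adapted \<gamma> k (\<lambda>\<omega>. snd (S (Suc k) \<omega>) j i))"
  proof (induction k)
    case 0
    have "adapted \<gamma> 0 (\<lambda>\<omega>. fst (S 0 \<omega>) i)" "adapted \<gamma> 0 (\<lambda>\<omega>. snd (S 0 \<omega>) j i)" for i j
      by (simp_all add: S_def adapted_const)
    then show ?case using input by blast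
  next
    case (Suc k)
    have 1: "adapted \<gamma> (Suc k) (\<lambda>\<omega>. fst (S (Suc k) \<omega>) i)" for i
      using Suc by (intro state) auto
    have 2: "adapted \<gamma> (Suc k) (\<lambda>\<omega>. snd (S (Suc k) \<omega>) j i)" for j i
      using Suc by (intro adapted_mono[of \<gamma> k _ "Suc k"]) auto
    show ?case using 1 2 input[of "Suc k"] by blast
  qed
  then show ?thesis unfolding S_def .
qed

lemma loop_state_adapted: "adapted \<gamma> k (\<lambda>\<omega>. loop_state A B \<mu> d W K x0 (\<lambda>k. \<gamma> k \<omega>) k i)"
  unfolding loop_state_def using closed_loop_adapted by blast

lemma loop_input_adapted:
  assumes "t \<le> int k"
  shows "adapted \<gamma> k (\<lambda>\<omega>. loop_input A B \<mu> d W K x0 (\<lambda>k. \<gamma> k \<omega>) t i)"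
proof (cases "t < 0")
  case True
  then show ?thesis by (simp add: loop_input_def adapted_const)
next
  case False
  have "adapted \<gamma> (nat t) (\<lambda>\<omega>. snd (closed_loop A B \<mu> d W K x0 (\<lambda>k. \<gamma> k \<omega>) (Suc (nat t))) 0 i)"
    using closed_loop_adapted by blast
  then have "adapted \<gamma> (nat t) (\<lambda>\<omega>. loop_input A B \<mu> d W K x0 (\<lambda>k. \<gamma> k \<omega>) t i)"
    using False by (simp add: loop_input_def del: closed_loop.simps)
  then show ?thesis by (rule adapted_mono) (use assms in simp)
qed

section \<open>Passage to expectations and contraction of the Laplacian modes\<close>

lemma integral_matrix_vector_mult:
  fixes T :: "real^'n^'m"
  assumes "integrable M f"
  shows "(\<integral>\<omega>. T *v f \<omega> \<partial>M) = T *v (\<integral>\<omega>. f \<omega> \<partial>M)"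
  using integral_bounded_linear[OF matrix_vector_mul_bounded_linear assms] .

lemma integrable_matrix_vector_mult:
  fixes T :: "real^'n^'m"
  shows "integrable M f \<Longrightarrow> integrable M (\<lambda>\<omega>. T *v f \<omega>)"
  by (rule integrable_bounded_linear[OF matrix_vector_mul_bounded_linear])

text \<open>The gain granted by consensusability serves all nonzero modes at once. A run started
  along \<open>v\<close> has a mean whose projection on \<open>v\<close> follows the powers of the
  mode matrix, and consensus forces this projection to 0.\<close>

lemma mode_contracts:
  fixes A :: "real^'n^'n" and B :: "real^'m^'n" and W :: "real^'v^'v"
  assumes M: "prob_space M" "iid_bernoulli M \<gamma> p"
    and W: "weighted_adjacency W" and A: "det A \<noteq> 0" and cons: "ms_consensusable M \<gamma> p d A B W"
  obtains K :: "real^'n^'m" where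
    "\<And>l v. l \<noteq> 0 \<Longrightarrow> v \<noteq> 0 \<Longrightarrow> laplacian W *v v = l *\<^sub>R v \<Longrightarrow>
      \<bar>det (A - ((1 - p) * l) *\<^sub>R (B ** K))\<bar> < 1"
proof -
  define \<mu> where "\<mu> = 1 - p"
  obtain K :: "real^'n^'m" where K: "\<And>x0 u0 x u i j.
      (\<forall>\<omega>\<in>space M. (\<forall>i. x 0 i \<omega> = x0 i) \<and> (\<forall>t\<in>{- int d..-1}. \<forall>i. u t i \<omega> = u0 t i) \<and>
         dynamics A B d (\<lambda>k. \<gamma> k \<omega>) (\<lambda>k i. x k i \<omega>) (\<lambda>t i. u t i \<omega>) \<and>
         predictor_protocol A B \<mu> d W K (\<lambda>k i. x k i \<omega>) (\<lambda>t i. u t i \<omega>)) \<Longrightarrow>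
      (\<lambda>k. \<integral>\<omega>. (norm (x k j \<omega> - x k i \<omega>))\<^sup>2 \<partial>M) \<longlonglongrightarrow> 0"
    using cons unfolding ms_consensusable_def \<mu>_def by blast
  note int = adapted_integrable[OF M]
  show ?thesis
  proof (rule that)
    fix l and v :: "real^'v" assume l: "l \<noteq> 0" and v0: "v \<noteq> 0" and v: "laplacian W *v v = l *\<^sub>R v"
    let ?F = "A - (\<mu> * l) *\<^sub>R (B ** K)"
    have "(\<lambda>k. mat_pow ?F k *v (mat_pow A d *v e)) \<longlonglongrightarrow> 0" for e
    proof -
      \<comment> \<open>The scaling makes the projection of the initial states on \<open>v\<close>
        equal to \<open>e\<close>.\<close>
      define x0 where "x0 i = (v $ i / (v \<bullet> v)) *\<^sub>R e" for i
      define x where "x k i \<omega> = loop_state A B \<mu> d W K x0 (\<lambda>k. \<gamma> k \<omega>) k i" for k i \<omega>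
      define u where "u t i \<omega> = loop_input A B \<mu> d W K x0 (\<lambda>k. \<gamma> k \<omega>) t i" for t i \<omega>
      define X where "X k i = (\<integral>\<omega>. x k i \<omega> \<partial>M)" for k i
      define U where "U t i = (\<integral>\<omega>. u t i \<omega> \<partial>M)" for t i
      have dyn: "dynamics A B d (\<lambda>k. \<gamma> k \<omega>) (\<lambda>k i. x k i \<omega>) (\<lambda>t i. u t i \<omega>)" for \<omega>
        unfolding x_def u_def by (rule closed_loop_dynamics)
      have prot: "predictor_protocol A B \<mu> d W K (\<lambda>k i. x k i \<omega>) (\<lambda>t i. u t i \<omega>)" for \<omega>
        unfolding x_def u_def by (rule closed_loop_protocol)
      have x_0: "x 0 i \<omega> = x0 i" for i \<omega> by (simp add: x_def loop_state_def)
      have u_neg: "u t i \<omega> = 0" if "t < 0" for t i \<omega> using that by (simp add: u_def loop_input_def)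
      have x_ad: "adapted \<gamma> k (x k i)" for k i unfolding x_def by (rule loop_state_adapted)
      have u_ad: "adapted \<gamma> k (u t i)" if "t \<le> int k" for t k i
        unfolding u_def using that by (rule loop_input_adapted)
      have x_int: "integrable M (x k i)" for k i by (rule int[OF x_ad])
      have u_int: "integrable M (u t i)" for t i by (rule int[OF u_ad[of t "nat t"]]) simp
      note ints = integrable_matrix_vector_mult x_int u_int

      \<comment> \<open>The input \<open>u (k - d)\<close> is adapted to time \<open>k\<close>, so
        the mean of its product with \<open>\<gamma> k\<close> factors.\<close>
      have dynX: "dynamics A B d (\<lambda>_. \<mu>) X U"
        unfolding dynamics_def
      proof (intro allI)
        fix k i
        have Bu: "adapted \<gamma> k (\<lambda>\<omega>. B *v u (int k - int d) i \<omega>)"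
          by (intro adapted_linear[OF matrix_vector_mul_linear] u_ad) simp
        have "X (k + 1) i = (\<integral>\<omega>. A *v x k i \<omega> + \<gamma> k \<omega> *\<^sub>R (B *v u (int k - int d) i \<omega>) \<partial>M)"
          using dyn by (simp add: X_def dynamics_def)
        also have "\<dots> = (\<integral>\<omega>. A *v x k i \<omega> \<partial>M) + (\<integral>\<omega>. \<gamma> k \<omega> *\<^sub>R (B *v u (int k - int d) i \<omega>) \<partial>M)"
          by (intro Bochner_Integration.integral_add ints int[OF adapted_channel[OF Bu]])
        also have "\<dots> = A *v X k i + \<mu> *\<^sub>R (B *v U (int k - int d) i)"
          unfolding adapted_channel_mean[OF M Bu] X_def U_def \<mu>_def
          by (simp add: integral_matrix_vector_mult ints)
        finally show "X (k + 1) i = A *v X k i + \<mu> *\<^sub>R (B *v U (int k - int d) i)" .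
      qed

      have protX: "predictor_protocol A B \<mu> d W K X U"
        unfolding predictor_protocol_def
      proof (intro allI impI)
        fix k i assume k: "d \<le> k"
        let ?P = "\<lambda>\<omega> j. prediction A B \<mu> d (\<lambda>k i. x k i \<omega>) (\<lambda>t i. u t i \<omega>) k j"
        have P_int: "integrable M (\<lambda>\<omega>. ?P \<omega> j)" for j
          unfolding prediction_def
          by (intro Bochner_Integration.integrable_add integrable_scaleR_right
              Bochner_Integration.integrable_sum ints)
        have P_mean: "(\<integral>\<omega>. ?P \<omega> j \<partial>M) = prediction A B \<mu> d X U k j" for j
          unfolding prediction_def X_def U_def
          by (subst Bochner_Integration.integral_add)
            (auto simp: integral_matrix_vector_mult Bochner_Integration.integral_sum ints
              intro!: integrable_scaleR_right Bochner_Integration.integrable_sum ints)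
        have "U (int k - int d) i =
            (\<integral>\<omega>. K *v (\<Sum>j\<in>neighbours W i. W $ i $ j *\<^sub>R (?P \<omega> j - ?P \<omega> i)) \<partial>M)"
          unfolding U_def
          by (intro Bochner_Integration.integral_cong refl)
            (use prot k in \<open>auto simp: predictor_protocol_def\<close>)
        also have "\<dots> = K *v (\<Sum>j\<in>neighbours W i. W $ i $ j *\<^sub>R
            (prediction A B \<mu> d X U k j - prediction A B \<mu> d X U k i))"
          by (simp add: integral_matrix_vector_mult P_int P_mean)
        finally show "U (int k - int d) i = K *v (\<Sum>j\<in>neighbours W i. W $ i $ j *\<^sub>R
            (prediction A B \<mu> d X U k j - prediction A B \<mu> d X U k i))" .
      qed

      have diff: "(\<lambda>k. X k j - X k i) \<longlonglongrightarrow> 0" for i j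
      proof -
        \<comment> \<open>The zero inputs at negative times serve as initial inputs.\<close>
        have lim: "(\<lambda>k. \<integral>\<omega>. (norm (x k j \<omega> - x k i \<omega>))\<^sup>2 \<partial>M) \<longlonglongrightarrow> 0"
          by (rule K[of x x0 u "\<lambda>_ _. 0"]) (use dyn prot x_0 u_neg in auto)
        have "(norm (X k j - X k i))\<^sup>2 \<le> (\<integral>\<omega>. (norm (x k j \<omega> - x k i \<omega>))\<^sup>2 \<partial>M)" for k
          using adapted_norm_mean_le[OF M adapted_diff[OF x_ad x_ad], of k j i]
          by (simp add: X_def x_int)
        then have "(\<lambda>k. (norm (X k j - X k i))\<^sup>2) \<longlonglongrightarrow> 0"
          by (intro tendsto_sandwich[OF _ _ tendsto_const lim]) auto
        then have "(\<lambda>k. sqrt ((norm (X k j - X k i))\<^sup>2)) \<longlonglongrightarrow> sqrt 0"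
          by (rule tendsto_real_sqrt)
        then show ?thesis by (simp add: tendsto_norm_zero_iff)
      qed

      define y where "y k = (\<Sum>i\<in>UNIV. v $ i *\<^sub>R X k i)" for k
      have y_lim: "y \<longlonglongrightarrow> 0"
      proof -
        obtain i0 :: 'v where True by simp
        \<comment> \<open>The entries of \<open>v\<close> sum to 0, so the state of a reference
          agent \<open>i0\<close> can be subtracted without changing \<open>y\<close>.\<close>
        have "y = (\<lambda>k. \<Sum>i\<in>UNIV. v $ i *\<^sub>R (X k i - X k i0))"
          using laplacian_eigenvector_sum[OF W v l]
          by (simp add: fun_eq_iff y_def scaleR_diff_right sum_subtractf scaleR_sum_left[symmetric])
        moreover have "(\<lambda>k. \<Sum>i\<in>UNIV. v $ i *\<^sub>R (X k i - X k i0)) \<longlonglongrightarrow> (\<Sum>i\<in>UNIV. v $ i *\<^sub>R 0)"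
          by (intro tendsto_intros diff)
        ultimately show ?thesis by simp
      qed
      \<comment> \<open>During the first \<open>d\<close> steps only the zero initial inputs arrive,
        so the mean states evolve freely; feedback acts from time \<open>d\<close> on.\<close>
      have "X k i = mat_pow A k *v x0 i" if "k \<le> d" for k i
        using that
      proof (induction k)
        case 0
        interpret prob_space M by (rule M)
        show ?case by (simp add: X_def x_0 prob_space)
      next
        case (Suc k)
        have "U (int k - int d) i = 0" using Suc.prems by (simp add: U_def u_neg)
        then show ?case
          using dynX Suc by (simp add: dynamics_def matrix_vector_mul_assoc[symmetric])
      qed
      then have "y d = (\<Sum>i\<in>UNIV. v $ i *\<^sub>R (mat_pow A d *v x0 i))" by (simp add: y_def)
      also have "\<dots> = mat_pow A d *v (\<Sum>i\<in>UNIV. v $ i *\<^sub>R x0 i)"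
        by (simp add: matrix_vector_mult_scaleR[symmetric] linear_sum[OF matrix_vector_mul_linear, symmetric])
      also have "(\<Sum>i\<in>UNIV. v $ i *\<^sub>R x0 i) = e"
      proof -
        have "(\<Sum>i\<in>UNIV. v $ i *\<^sub>R x0 i) = (\<Sum>i\<in>UNIV. v $ i * v $ i / (v \<bullet> v)) *\<^sub>R e"
          by (simp add: x0_def scaleR_sum_left)
        also have "(\<Sum>i\<in>UNIV. v $ i * v $ i / (v \<bullet> v)) = (v \<bullet> v) / (v \<bullet> v)"
          by (simp only: sum_divide_distrib[symmetric] inner_vec_def inner_real_def)
        finally have "(\<Sum>i\<in>UNIV. v $ i *\<^sub>R x0 i) = ((v \<bullet> v) / (v \<bullet> v)) *\<^sub>R e" .
        then show ?thesis using v0 by simp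
      qed
      finally have y_d: "y d = mat_pow A d *v e" .
      have "y (k + d) = mat_pow ?F k *v (mat_pow A d *v e)" for k
      proof (induction k)
        case (Suc k)
        have "y (Suc (k + d)) = ?F *v y (k + d)"
          unfolding y_def by (rule mean_mode_step[OF W v dynX protX]) simp
        then show ?case using Suc by (simp add: matrix_vector_mul_assoc[symmetric])
      qed (simp add: y_d)
      then show ?thesis using LIMSEQ_ignore_initial_segment[OF y_lim, of d] by simp
    qed
    \<comment> \<open>Since \<open>det A\<close> is nonzero, \<open>mat_pow A d\<close> is
      invertible and the modes at time \<open>d\<close> reach every direction.\<close>
    then have "\<bar>det ?F\<bar> < 1"
      by (rule abs_det_less_1) (simp add: det_mat_pow A)
    then show "\<bar>det (A - ((1 - p) * l) *\<^sub>R (B ** K))\<bar> < 1" by (simp add: \<mu>_def)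
  qed
qed

text \<open>With a single input, \<open>B ** K\<close> is the outer product of the column of
  \<open>B\<close> and the row of \<open>K\<close>, so the rank-one update applies with parameter
  \<open>- s\<close>.\<close>

lemma det_single_input_feedback:
  fixes A :: "real^'n^'n" and B :: "real^'m^'n"
  assumes "CARD('m) = 1"
  obtains a where "\<And>s. det (A - s *\<^sub>R (B ** K)) = det A - s * a"
proof -
  obtain m :: 'm where m: "UNIV = {m}" using assms by (auto simp: card_1_singleton_iff)
  obtain a where a: "\<And>s. det (\<chi> i. A $ i + (s * B $ i $ m) *s (K $ m)) = det A + s * a"
    using det_rank_one_update[of A "\<lambda>i. B $ i $ m" "K $ m"] by blast
  have "det (A - s *\<^sub>R (B ** K)) = det A - s * a" for s
  proof -
    have "A - s *\<^sub>R (B ** K) = (\<chi> i. A $ i + (- s * B $ i $ m) *s (K $ m))"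
      by (simp add: vec_eq_iff matrix_matrix_mult_def m)
    then show ?thesis using a[of "- s"] by simp
  qed
  then show ?thesis by (rule that)
qed

section \<open>Combination of the determinant constraints at the second and the largest Laplacian
  eigenvalue\<close>

theorem theorem4:
  fixes A :: "real^'n^'n" and B :: "real^'m^'n" and W :: "real^'v^'v"
    and M :: "'w measure" and \<gamma> :: "nat \<Rightarrow> 'w \<Rightarrow> real" and p :: real and d :: nat
  assumes "CARD('v) \<ge> 2"
    and "prob_space M" and "0 < p" and "p < 1" and "iid_bernoulli M \<gamma> p"
    and "\<forall>z \<in># eigvals A. 1 \<le> cmod z"
    and "rank B = CARD('m)"
    and "rank B = 1"
    and "weighted_adjacency W" and "connected_graph W"
    and "ms_consensusable M \<gamma> p d A B W"
  shows "ereal (\<Prod>z \<in># unstable_eigvals A. (cmod z)\<^sup>2) <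
    (let l2 = laplacian_eigval W 2; lN = laplacian_eigval W CARD('v) in
      if l2 = lN then \<infinity> else ereal (((1 + l2 / lN) / (1 - l2 / lN))\<^sup>2))"
proof -
  define l where "l = laplacian_eigval W 2"
  define h where "h = laplacian_eigval W CARD('v)"
  have l: "0 < l" unfolding l_def by (rule laplacian_eigval_2_pos[OF assms(9,10,1)])
  have lh: "l \<le> h" unfolding l_def h_def using assms(1) by (intro laplacian_eigval_mono) auto
  \<comment> \<open>All eigenvalues are unstable, so the product runs over the whole spectrum and
    becomes the squared determinant.\<close>
  have "unstable_eigvals A = eigvals A"
    unfolding unstable_eigvals_def using assms(6) by (simp add: filter_mset_eq_conv)
  moreover have "(\<Prod>z\<in>#X. (cmod z)\<^sup>2) = (\<Prod>z\<in>#X. cmod z)\<^sup>2" for X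
    by (induction X) (auto simp: power_mult_distrib)
  ultimately have prod: "(\<Prod>z\<in>#unstable_eigvals A. (cmod z)\<^sup>2) = (det A)\<^sup>2"
    by (simp add: prod_cmod_eigvals)
  have "1 \<le> (\<Prod>z\<in>#X. cmod z)" if "\<forall>z\<in>#X. 1 \<le> cmod z" for X
    using that
  proof (induction X)
    case (add z X)
    then show ?case using mult_mono[of 1 "cmod z" 1 "\<Prod>z\<in>#X. cmod z"] by simp
  qed simp
  from this[OF assms(6)] have det: "1 \<le> \<bar>det A\<bar>" by (simp add: prod_cmod_eigvals)
  then have "det A \<noteq> 0" by auto
  then obtain K :: "real^'n^'m" where K: "\<And>l v. l \<noteq> 0 \<Longrightarrow> v \<noteq> 0 \<Longrightarrow> laplacian W *v v = l *\<^sub>R v \<Longrightarrow>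
      \<bar>det (A - ((1 - p) * l) *\<^sub>R (B ** K))\<bar> < 1"
    using mode_contracts[OF assms(2,5,9) _ assms(11)] by blast
  \<comment> \<open>Full column rank together with rank 1 leaves a single input.\<close>
  obtain a where a: "\<And>s. det (A - s *\<^sub>R (B ** K)) = det A - s * a"
    using det_single_input_feedback[of A B K] assms(7,8) by auto
  have bound: "\<bar>det A - laplacian_eigval W k * ((1 - p) * a)\<bar> < 1"
    if k: "1 \<le> k" "k \<le> CARD('v)" and pos: "0 < laplacian_eigval W k" for k
  proof -
    obtain v where "v \<noteq> 0" "laplacian W *v v = laplacian_eigval W k *\<^sub>R v"
      by (rule laplacian_eigval_vector[OF assms(9) k])
    with K[of "laplacian_eigval W k" v] pos show ?thesis by (simp add: a mult_ac)
  qed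
  \<comment> \<open>The same gain serves both modes, so both constraints share the slope
    \<open>(1 - p) * a\<close>. For \<open>l = h\<close> the right-hand side is infinite.\<close>
  have "(det A)\<^sup>2 < ((1 + l / h) / (1 - l / h))\<^sup>2" if "l \<noteq> h"
    using that lh l bound[of 2] bound[of "CARD('v)"] assms(1)
    by (intro ratio_bound[OF det l, of h "(1 - p) * a"]) (auto simp: l_def h_def)
  then show ?thesis
    unfolding prod by (simp add: Let_def l_def[symmetric] h_def[symmetric])
qed

end
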